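(* Let $\alpha\in\mathbb{R}$ and $v\in L^2_{\mathbb{C}}(0,1)$. (i) For any $z_n\in\sigma_0$, a corresponding eigenfunction of $L_\alpha$ (for the eigenvalue $z_n$) is $u_n(\alpha,x)=\mathrm{e}^{2n\pi\mathrm{i}x}$. (ii) For each $\mu_p\in\sigma_2$, a corresponding eigenfunction of $L_\alpha$ (for the eigenvalue $\mu_p$) is $$\widetilde{u}_p(\alpha,x)=\frac{1}{\sqrt{G'(\mu_p)}}\sum_{z_n\in\sigma_1}\frac{v_n}{z_n-\mu_p}\,u_n(x).$$
   Context: $\langle f,g\rangle=\int_0^1 f(x)\overline{g(x)}\,dx$ on $L^2_{\mathbb{C}}(0,1)$. The operator $L_\alpha=L_\alpha(v)$ is $(L_\alpha y)(x)=\mathrm{i}y'''(x)+\alpha\langle y,v\rangle v(x)$ with domain $\{y\in W_3^2(0,1): y(1)=y(0),\ y'(1)=y'(0),\ y''(1)=y''(0)\}$, where $W_3^2(0,1)$ is the Sobolev space of functions with three derivatives in $L^2$. For $n\in\mathbb{Z}$: $z_n=(2n\pi)^3$, $u_n(x)=\mathrm{e}^{2n\pi\mathrm{i}x}$, $v_n=\langle v,u_n\rangle$. The spectrum of $L_0$ is $\{z_n\}_{n\in\mathbb{Z}}$, and one sets $\sigma_0=\{z_n: v_n=0\}$, $\sigma_1=\{z_n: v_n\ne 0\}$, $$G(z)=\sum_{z_n\in\sigma_1}\frac{|v_n|^2}{z_n-z},\qquad Q(z)=1+\alpha G(z),\qquad \sigma_2=\{\mu: Q(\mu)=0\}.$$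 *)

theory Defs
  imports "HOL-Analysis.Analysis"
begin

abbreviation unit_int :: "real measure" where
  "unit_int \<equiv> lebesgue_on {0<..<1}"

text \<open>Elements of the Hilbert space are represented by functions; equality in it is
  equality almost everywhere with respect to \<open>unit_int\<close>.\<close>

definition L2 :: "(real \<Rightarrow> complex) set" where
  "L2 = {f. f \<in> borel_measurable unit_int \<and> integrable unit_int (\<lambda>x. (cmod (f x))\<^sup>2)}"

definition ip :: "(real \<Rightarrow> complex) \<Rightarrow> (real \<Rightarrow> complex) \<Rightarrow> complex" where
  "ip f g = (LINT x|unit_int. f x * cnj (g x))"

definition test_function :: "(real \<Rightarrow> real) \<Rightarrow> bool" where
  "test_function \<phi> \<longleftrightarrow> (\<forall>k x. ((deriv ^^ k) \<phi>) differentiable (at x)) \<and>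
     closure {x. \<phi> x \<noteq> 0} \<subseteq> {0<..<1}"

text \<open>\<open>g\<close> is a weak (distributional) derivative of \<open>f\<close> of order \<open>k\<close> on the open unit interval.
  For \<open>k = 0\<close> this says that \<open>f\<close> and \<open>g\<close> agree almost everywhere. Real test functions
  suffice, by linearity.\<close>

definition weak_deriv :: "nat \<Rightarrow> (real \<Rightarrow> complex) \<Rightarrow> (real \<Rightarrow> complex) \<Rightarrow> bool" where
  "weak_deriv k f g \<longleftrightarrow> (\<forall>\<phi>. test_function \<phi> \<longrightarrow>
     (LINT x|unit_int. f x * of_real ((deriv ^^ k) \<phi> x)) =
       (-1) ^ k * (LINT x|unit_int. g x * of_real (\<phi> x)))"

definition sobolev2 :: "nat \<Rightarrow> (real \<Rightarrow> complex) set" where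
  "sobolev2 m = {f \<in> L2. \<forall>k\<le>m. \<exists>g\<in>L2. weak_deriv k f g}"

text \<open>The boundary values of the \<open>k\<close>-th derivative (\<open>k \<le> 2\<close>) are those of its representative
  \<open>g\<close> that is continuous up to the boundary; it is unique on the closed interval.\<close>

definition dom_L :: "(real \<Rightarrow> complex) set" where
  "dom_L = {y \<in> sobolev2 3.
     \<forall>k\<le>2. \<exists>g. continuous_on {0..1} g \<and> weak_deriv k y g \<and> g 1 = g 0}"

text \<open>The operator is given by its graph: \<open>(y, w)\<close> belongs to it iff \<open>y\<close> is in the domain and
  \<open>w\<close> is a representative of the image of \<open>y\<close>; \<open>y3\<close> is the third derivative of \<open>y\<close>, determined
  almost everywhere.\<close>

definition L_op ::
    "real \<Rightarrow> (real \<Rightarrow> complex) \<Rightarrow> ((real \<Rightarrow> complex) \<times> (real \<Rightarrow> complex)) set" where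
  "L_op \<alpha> v = {(y, w). y \<in> dom_L \<and>
     (\<exists>y3\<in>L2. weak_deriv 3 y y3 \<and>
        (AE x in unit_int. w x = \<i> * y3 x + of_real \<alpha> * ip y v * v x))}"

definition eigenfunction ::
    "((real \<Rightarrow> complex) \<times> (real \<Rightarrow> complex)) set \<Rightarrow> complex \<Rightarrow> (real \<Rightarrow> complex) \<Rightarrow> bool" where
  "eigenfunction T c y \<longleftrightarrow>
     (y, \<lambda>x. c * y x) \<in> T \<and> \<not> (AE x in unit_int. y x = 0)"

definition zev :: "int \<Rightarrow> complex" where
  "zev n = of_real ((2 * of_int n * pi) ^ 3)"

definition ufun :: "int \<Rightarrow> real \<Rightarrow> complex" where
  "ufun n x = exp (2 * of_int n * of_real pi * \<i> * of_real x)"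

definition vcoeff :: "(real \<Rightarrow> complex) \<Rightarrow> int \<Rightarrow> complex" where
  "vcoeff v n = ip v (ufun n)"

definition sigma0 :: "(real \<Rightarrow> complex) \<Rightarrow> complex set" where
  "sigma0 v = {zev n | n. vcoeff v n = 0}"

definition sigma1 :: "(real \<Rightarrow> complex) \<Rightarrow> complex set" where
  "sigma1 v = {zev n | n. vcoeff v n \<noteq> 0}"

definition Gfun :: "(real \<Rightarrow> complex) \<Rightarrow> complex \<Rightarrow> complex" where
  "Gfun v z = (\<Sum>\<^sub>\<infinity>n\<in>{n. zev n \<in> sigma1 v}. of_real ((cmod (vcoeff v n))\<^sup>2) / (zev n - z))"

definition Qfun :: "real \<Rightarrow> (real \<Rightarrow> complex) \<Rightarrow> complex \<Rightarrow> complex" where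
  "Qfun \<alpha> v z = 1 + of_real \<alpha> * Gfun v z"

text \<open>The points of \<open>sigma1 v\<close> are poles of \<open>Qfun \<alpha> v\<close>; since division by zero is total, they
  have to be excluded explicitly.\<close>

definition sigma2 :: "real \<Rightarrow> (real \<Rightarrow> complex) \<Rightarrow> complex set" where
  "sigma2 \<alpha> v = {\<mu>. \<mu> \<notin> sigma1 v \<and> Qfun \<alpha> v \<mu> = 0}"

definition utilde :: "(real \<Rightarrow> complex) \<Rightarrow> complex \<Rightarrow> real \<Rightarrow> complex" where
  "utilde v \<mu> x = 1 / csqrt (deriv (Gfun v) \<mu>) *
     (\<Sum>\<^sub>\<infinity>n\<in>{n. zev n \<in> sigma1 v}. vcoeff v n / (zev n - \<mu>) * ufun n x)"

end

theory Submission
  imports Defs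
begin

text \<open>The weak derivatives of \<open>ufun n\<close> are its multiples by powers of \<open>2 n \<pi> \<i>\<close>, which settles
  the first part. For the second, put \<open>c n = v\<^sub>n / (z\<^sub>n - \<mu>)\<close> and \<open>y = \<Sum> c n u\<^sub>n\<close>. By Bessel's
  inequality and the cubic growth of \<open>z\<^sub>n\<close>, \<open>\<Sum> n\<^sup>2 \<bar>c n\<bar>\<close> converges, so \<open>y\<close> and its first two
  derivatives are uniformly convergent series of periodic functions. The third derivative
  converges only in the sense of distributions: since \<open>z\<^sub>n c n = v\<^sub>n + \<mu> c n\<close>, pairing with a test
  function shows that it is \<open>- \<i> (v + \<mu> y)\<close>, provided that the Fourier series of \<open>v\<close> may be
  paired termwise with test functions; that follows from the pointwise convergence of the
  Fourier series of a test function. Finally \<open>\<alpha> \<langle>y, v\<rangle> = \<alpha> G \<mu> = -1\<close> cancels \<open>v\<close> and also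
  shows that \<open>y\<close> does not vanish. The normalising factor is nonzero since \<open>G \<mu> = -1 / \<alpha>\<close>
  forces \<open>\<mu>\<close> to be real.\<close>

subsection \<open>Exponentials and test functions\<close>

text \<open>Eigenvalue of d/dx on \<open>ufun n\<close>: differentiating \<open>k\<close> times
  multiplies the coefficient of \<open>ufun n\<close> by \<open>freq n ^ k\<close>.\<close>

definition freq :: "int \<Rightarrow> complex" where
  "freq n = 2 * of_int n * of_real pi * \<i>"

lemma ufun_eq: "ufun n x = exp (freq n * of_real x)"
  by (simp add: ufun_def freq_def)

lemma ufun_add: "ufun (m + n) x = ufun m x * ufun n x"
  by (simp add: ufun_eq freq_def algebra_simps flip: exp_add)

lemma cnj_ufun: "cnj (ufun n x) = ufun (- n) x"
  by (simp add: ufun_def exp_cnj)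

lemma norm_ufun [simp]: "norm (ufun n x) = 1"
  by (simp add: ufun_def norm_exp_eq_Re)

lemma ufun_nonzero [simp]: "ufun n x \<noteq> 0"
  by (simp add: ufun_def)

lemma ufun_0 [simp]: "ufun 0 x = 1"
  by (simp add: ufun_def)

lemma ufun_at_0 [simp]: "ufun n 0 = 1"
  by (simp add: ufun_def)

lemma ufun_at_1 [simp]: "ufun n 1 = 1"
proof -
  have "exp (2 * of_int n * of_real pi * \<i> :: complex) = 1"
    using exp_2pi_1_int[of n] by (simp add: algebra_simps)
  then show ?thesis
    by (simp add: ufun_def)
qed

lemma ufun_diff_arg: "ufun n (x - y) = ufun n x * ufun (- n) y"
  by (simp add: ufun_def algebra_simps flip: exp_add)

lemma continuous_on_ufun [continuous_intros]: "continuous_on S (ufun n)"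
  unfolding ufun_def by (intro continuous_intros)

lemma ufun_has_vector_derivative:
  "(ufun n has_vector_derivative freq n * ufun n x) (at x within S)"
proof -
  have "((\<lambda>z. exp (freq n * z)) has_field_derivative freq n * exp (freq n * of_real x)) (at (of_real x))"
    by (auto intro!: derivative_eq_intros)
  then have "((\<lambda>t. exp (freq n * of_real t)) has_vector_derivative freq n * exp (freq n * of_real x)) (at x)"
    by (rule has_vector_derivative_real_field)
  then show ?thesis
    unfolding ufun_eq[abs_def] by (rule has_vector_derivative_at_within)
qed

lemma freq_eq_0_iff [simp]: "freq n = 0 \<longleftrightarrow> n = 0"
  by (simp add: freq_def)

lemma norm_freq: "norm (freq n) = 2 * pi * \<bar>of_int n\<bar>"
  by (simp add: freq_def norm_mult)

text \<open>Links the differential expression with the unperturbed spectrum: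
  \<open>\<i> * freq n ^ 3\<close> is \<open>zev n\<close>.\<close>

lemma freq_cube: "freq n ^ 3 = - (\<i> * zev n)"
  by (simp add: freq_def zev_def power3_eq_cube algebra_simps)

lemma vcoeff_eq: "vcoeff v n = (LINT x|unit_int. ufun (- n) x * v x)"
  by (simp add: vcoeff_def ip_def cnj_ufun mult.commute)

section \<open>Integration of continuous functions over the unit interval\<close>

lemma integrable_unit_int_continuous:
  fixes f :: "real \<Rightarrow> 'a::euclidean_space"
  assumes "continuous_on {0..1} f"
  shows "integrable unit_int f"
proof -
  have "f absolutely_integrable_on {0..1}"
    by (simp add: absolutely_integrable_continuous_real assms)
  then have "f absolutely_integrable_on {0<..<1}"
    by (simp add: absolutely_integrable_on_Icc_iff_Ioo)
  then show ?thesis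
    by (intro absolutely_integrable_imp_integrable) auto
qed

lemma integrable_unit_int_mult_continuous:
  fixes f g :: "real \<Rightarrow> complex"
  assumes f: "integrable unit_int f" and g: "continuous_on {0..1} g"
  shows "integrable unit_int (\<lambda>x. g x * f x)"
proof -
  have "compact (g ` {0..1})"
    using g by (intro compact_continuous_image) auto
  then obtain C where C: "\<And>x. x \<in> {0..1} \<Longrightarrow> norm (g x) \<le> C"
    using bounded_iff compact_imp_bounded by (metis image_eqI)
  have [measurable]: "g \<in> borel_measurable unit_int" "f \<in> borel_measurable unit_int"
    using integrable_unit_int_continuous[OF g] f by auto
  show ?thesis
  proof (rule Bochner_Integration.integrable_bound)
    show "integrable unit_int (\<lambda>x. C * norm (f x))"
      using f by simp
    show "AE x in unit_int. norm (g x * f x) \<le> norm (C * norm (f x))"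
    proof (rule AE_I2)
      fix x assume "x \<in> space unit_int"
      then have "norm (g x) \<le> C"
        using C by auto
      moreover have "C \<le> \<bar>C\<bar>" by simp
      ultimately show "norm (g x * f x) \<le> norm (C * norm (f x))"
        by (auto simp: norm_mult abs_mult intro!: mult_right_mono)
    qed
  qed measurable
qed

lemma integral_unit_int_FTC:
  fixes F :: "real \<Rightarrow> 'a::euclidean_space"
  assumes "\<And>x. (F has_vector_derivative f x) (at x)" and f: "continuous_on {0..1} f"
  shows "(LINT x|unit_int. f x) = F 1 - F 0"
proof -
  have "(f has_integral (F 1 - F 0)) {0..1}"
    by (rule fundamental_theorem_of_calculus) (auto intro: has_vector_derivative_at_within assms)
  then have "integral {0<..<1} f = F 1 - F 0"
    by (simp add: has_integral_Icc_iff_Ioo integral_unique)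
  then show ?thesis
    using lebesgue_integral_eq_integral[OF integrable_unit_int_continuous[OF f]] by simp
qed

lemma integral_ufun: "(LINT x|unit_int. ufun n x) = (if n = 0 then 1 else 0)"
proof (cases "n = 0")
  case True
  have "(LINT x|unit_int. (1::complex)) = of_real 1 - of_real 0"
    by (rule integral_unit_int_FTC[where F = of_real])
       (auto intro!: derivative_eq_intros simp: has_real_derivative_iff_has_vector_derivative)
  then show ?thesis using True by simp
next
  case False
  have "(LINT x|unit_int. ufun n x) = ufun n 1 / freq n - ufun n 0 / freq n"
  proof (rule integral_unit_int_FTC)
    show "((\<lambda>x. ufun n x / freq n) has_vector_derivative ufun n x) (at x)" for x
      using has_vector_derivative_mult_left[OF ufun_has_vector_derivative[of n x UNIV], of "inverse (freq n)"] False
      by (simp add: field_simps)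
  qed (intro continuous_intros)
  then show ?thesis using False by simp
qed

section \<open>Test functions and their exponential integrals\<close>

lemma test_function_derivs:
  assumes "test_function \<phi>"
  shows "((deriv ^^ k) \<phi> has_real_derivative (deriv ^^ Suc k) \<phi> x) (at x within S)"
proof -
  have "(deriv ^^ k) \<phi> differentiable at x"
    using assms unfolding test_function_def by blast
  then have "((deriv ^^ k) \<phi> has_real_derivative deriv ((deriv ^^ k) \<phi>) x) (at x)"
    by (simp only: DERIV_deriv_iff_real_differentiable)
  then show ?thesis
    unfolding funpow.simps comp_def by (rule has_field_derivative_at_within)
qed

lemma continuous_on_test_function_derivs:
  assumes "test_function \<phi>"
  shows "continuous_on S ((deriv ^^ k) \<phi>)"
  using test_function_derivs[OF assms] by (intro DERIV_continuous_on)

text \<open>Off the closed support the function vanishes on an open set, so inductively every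
  derivative vanishes there too. This removes the boundary terms at 0 and 1 when integrating by
  parts.\<close>

lemma test_function_boundary:
  assumes "test_function \<phi>" "x \<notin> {0<..<1}"
  shows "(deriv ^^ k) \<phi> x = 0"
proof -
  have "(deriv ^^ k) \<phi> x = 0" if "x \<in> - closure {x. \<phi> x \<noteq> 0}" for x
    using that
  proof (induction k arbitrary: x)
    case 0
    then show ?case
      using closure_subset[of "{x. \<phi> x \<noteq> 0}"] by auto
  next
    case (Suc k)
    have "((\<lambda>x. 0) has_real_derivative (deriv ^^ Suc k) \<phi> x) (at x)"
      by (rule has_field_derivative_transform_within_open[OF test_function_derivs[OF assms(1)]
            _ Suc.prems])
         (use Suc.IH in auto)
    then show ?case
      using DERIV_unique[OF _ DERIV_const] by blast
  qed
  then show ?thesis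
    using assms unfolding test_function_def by blast
qed

text \<open>Integration by parts \<open>k\<close> times. It serves twice: to compute weak
  derivatives, and to show the decay of the Fourier coefficients of a test function.\<close>

lemma integral_ufun_test_function_derivs:
  assumes "test_function \<phi>"
  shows "(LINT x|unit_int. ufun n x * of_real ((deriv ^^ k) \<phi> x)) =
     (- freq n) ^ k * (LINT x|unit_int. ufun n x * of_real (\<phi> x))"
proof (induction k)
  case (Suc k)
  let ?\<phi> = "\<lambda>k x. of_real ((deriv ^^ k) \<phi> x) :: complex"
  have cont: "continuous_on {0..1} (?\<phi> k)" for k
    by (intro continuous_intros continuous_on_test_function_derivs assms)
  have "(LINT x|unit_int. ufun n x * ?\<phi> (Suc k) x + freq n * ufun n x * ?\<phi> k x)
       = ufun n 1 * ?\<phi> k 1 - ufun n 0 * ?\<phi> k 0"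
  proof (rule integral_unit_int_FTC)
    fix x
    have "(?\<phi> k has_vector_derivative ?\<phi> (Suc k) x) (at x)"
      using test_function_derivs[OF assms, of k x UNIV] by (simp only: has_vector_derivative_of_real has_real_derivative_iff_has_vector_derivative)
    then show "((\<lambda>x. ufun n x * ?\<phi> k x) has_vector_derivative
        (ufun n x * ?\<phi> (Suc k) x + freq n * ufun n x * ?\<phi> k x)) (at x)"
      using has_vector_derivative_mult[OF ufun_has_vector_derivative] by blast
    show "continuous_on {0..1} (\<lambda>x. ufun n x * ?\<phi> (Suc k) x + freq n * ufun n x * ?\<phi> k x)"
      by (intro continuous_intros cont)
  qed
  also have "\<dots> = 0"
    using test_function_boundary[OF assms] by simp
  also have "(LINT x|unit_int. ufun n x * ?\<phi> (Suc k) x + freq n * ufun n x * ?\<phi> k x)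
     = (LINT x|unit_int. ufun n x * ?\<phi> (Suc k) x) + freq n * (LINT x|unit_int. ufun n x * ?\<phi> k x)"
    by (subst Bochner_Integration.integral_add)
       (auto simp: mult.assoc simp del: funpow.simps
         intro!: integrable_unit_int_continuous continuous_intros cont)
  finally show ?case
    unfolding Suc by (simp add: add_eq_0_iff2 mult.assoc)
qed simp

section \<open>Absolutely convergent exponential series\<close>

lemma continuous_on_ufun_series:
  assumes "(\<lambda>n. norm (c n)) summable_on A"
  shows "continuous_on S (\<lambda>x. \<Sum>\<^sub>\<infinity>n\<in>A. c n * ufun n x)"
proof (rule uniform_limit_theorem)
  show "uniform_limit S (\<lambda>F x. \<Sum>n\<in>F. c n * ufun n x) (\<lambda>x. \<Sum>\<^sub>\<infinity>n\<in>A. c n * ufun n x)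
      (finite_subsets_at_top A)"
    by (rule Weierstrass_m_test_general[OF _ assms]) (simp add: norm_mult)
  show "\<forall>\<^sub>F F in finite_subsets_at_top A. continuous_on S (\<lambda>x. \<Sum>n\<in>F. c n * ufun n x)"
    by (intro always_eventually allI continuous_intros)
qed simp

text \<open>By the M-test the partial sums converge uniformly on the closed interval, so after
  multiplication by \<open>f\<close> the error is a small constant times the L1 norm of
  \<open>f\<close>.\<close>

lemma ufun_series_integral:
  fixes f :: "real \<Rightarrow> complex"
  assumes c: "(\<lambda>n. norm (c n)) summable_on A" and f: "integrable unit_int f"
  shows "((\<lambda>n. c n * (LINT x|unit_int. ufun n x * f x)) has_sum
     (LINT x|unit_int. (\<Sum>\<^sub>\<infinity>n\<in>A. c n * ufun n x) * f x)) A"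
  unfolding has_sum_def
proof (rule tendstoI)
  let ?y = "\<lambda>x. \<Sum>\<^sub>\<infinity>n\<in>A. c n * ufun n x"
  let ?s = "\<lambda>F x. \<Sum>n\<in>F. c n * ufun n x"
  let ?I = "LINT x|unit_int. norm (f x)"
  fix e :: real assume "e > 0"
  \<comment> \<open>The tolerance is divided by \<open>?I + 1\<close> and not by \<open>?I\<close>,
    which may be 0.\<close>
  have I: "?I \<ge> 0"
    by simp
  then have e': "e / (?I + 1) > 0"
    using \<open>e > 0\<close> by (intro divide_pos_pos) linarith+
  have "uniform_limit {0..1} ?s ?y (finite_subsets_at_top A)"
    by (rule Weierstrass_m_test_general[OF _ c]) (simp add: norm_mult)
  then have "\<forall>\<^sub>F F in finite_subsets_at_top A. \<forall>x\<in>{0..1}. dist (?s F x) (?y x) < e / (?I + 1)"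
    using e' by (rule uniform_limitD)
  then show "\<forall>\<^sub>F F in finite_subsets_at_top A.
      dist (\<Sum>n\<in>F. c n * (LINT x|unit_int. ufun n x * f x)) (LINT x|unit_int. ?y x * f x) < e"
  proof eventually_elim
    case (elim F)
    have int: "integrable unit_int (\<lambda>x. ufun n x * f x)" for n
      by (intro integrable_unit_int_mult_continuous f continuous_intros)
    have int2: "integrable unit_int (\<lambda>x. ?s F x * f x)"
      by (intro integrable_unit_int_mult_continuous f continuous_intros)
    have int3: "integrable unit_int (\<lambda>x. ?y x * f x)"
      by (intro integrable_unit_int_mult_continuous f continuous_on_ufun_series c)
    have "(\<Sum>n\<in>F. c n * (LINT x|unit_int. ufun n x * f x)) = (LINT x|unit_int. ?s F x * f x)"
      using int by (simp add: sum_distrib_right mult.assoc)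
    then have "dist (\<Sum>n\<in>F. c n * (LINT x|unit_int. ufun n x * f x)) (LINT x|unit_int. ?y x * f x)
       = norm (LINT x|unit_int. ?s F x * f x - ?y x * f x)"
      using int2 int3 by (simp add: dist_norm)
    also have "\<dots> \<le> (LINT x|unit_int. norm (?s F x * f x - ?y x * f x))"
      by (rule integral_norm_bound)
    also have "\<dots> \<le> (LINT x|unit_int. e / (?I + 1) * norm (f x))"
    proof (rule integral_mono)
      fix x assume "x \<in> space unit_int"
      then have "norm (?s F x - ?y x) \<le> e / (?I + 1)"
        using elim[rule_format, of x] by (simp add: dist_norm)
      then have "norm (?s F x - ?y x) * norm (f x) \<le> e / (?I + 1) * norm (f x)"
        by (rule mult_right_mono) simp
      then show "norm (?s F x * f x - ?y x * f x) \<le> e / (?I + 1) * norm (f x)"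
        by (simp add: norm_mult flip: left_diff_distrib)
    qed (use f int2 int3 in auto)
    also have "\<dots> = e * (?I / (?I + 1))"
      by simp
    also have "\<dots> < e * 1"
    proof (rule mult_strict_left_mono)
      show "?I / (?I + 1) < 1"
        using I by (subst divide_less_eq_1_pos) linarith+
    qed fact
    finally show ?case by simp
  qed
qed

subsection \<open>Fourier coefficients and Fourier series\<close>

lemma L2_continuous:
  assumes "continuous_on {0..1} f"
  shows "f \<in> L2"
  using assms integrable_unit_int_continuous[OF assms] unfolding L2_def
  by (auto intro!: integrable_unit_int_continuous continuous_intros)

text \<open>The interval has finite measure, so \<open>1 + (cmod (f x))\<^sup>2\<close> is an
  integrable majorant.\<close>

lemma L2_integrable:
  assumes "f \<in> L2"
  shows "integrable unit_int f"
proof (rule Bochner_Integration.integrable_bound)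
  show "integrable unit_int (\<lambda>x. 1 + (cmod (f x))\<^sup>2)"
    using assms integrable_unit_int_continuous[OF continuous_on_const, of "1::real"]
    by (intro Bochner_Integration.integrable_add) (auto simp: L2_def)
  have "t \<le> 1 + t\<^sup>2" for t :: real
  proof -
    have "0 \<le> (t - 1)\<^sup>2" "0 \<le> t\<^sup>2"
      by simp_all
    then show ?thesis
      unfolding power2_diff power_one by linarith
  qed
  then show "AE x in unit_int. cmod (f x) \<le> norm (1 + (cmod (f x))\<^sup>2)"
    by (intro AE_I2) simp
qed (use assms in \<open>simp add: L2_def\<close>)

lemma L2_add:
  assumes "f \<in> L2" "g \<in> L2"
  shows "(\<lambda>x. f x + g x) \<in> L2"
proof -
  have [measurable]: "f \<in> borel_measurable unit_int" "g \<in> borel_measurable unit_int"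
    and int: "integrable unit_int (\<lambda>x. 2 * (cmod (f x))\<^sup>2 + 2 * (cmod (g x))\<^sup>2)"
    using assms by (auto simp: L2_def)
  have "integrable unit_int (\<lambda>x. (cmod (f x + g x))\<^sup>2)"
  proof (rule Bochner_Integration.integrable_bound[OF int])
    show "AE x in unit_int. norm ((cmod (f x + g x))\<^sup>2) \<le> norm (2 * (cmod (f x))\<^sup>2 + 2 * (cmod (g x))\<^sup>2)"
    proof (rule AE_I2)
      fix x
      have "(cmod (f x + g x))\<^sup>2 \<le> (cmod (f x) + cmod (g x))\<^sup>2"
        by (intro power_mono norm_triangle_ineq) simp
      also have "\<dots> \<le> 2 * (cmod (f x))\<^sup>2 + 2 * (cmod (g x))\<^sup>2"
        using zero_le_power2[of "cmod (f x) - cmod (g x)"] by (simp add: power2_diff power2_sum)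
      finally show "norm ((cmod (f x + g x))\<^sup>2) \<le> norm (2 * (cmod (f x))\<^sup>2 + 2 * (cmod (g x))\<^sup>2)"
        by simp
    qed
  qed measurable
  then show ?thesis
    by (simp add: L2_def)
qed

lemma L2_cmult:
  assumes "f \<in> L2"
  shows "(\<lambda>x. c * f x) \<in> L2"
  using assms by (auto simp: L2_def norm_mult power_mult_distrib)

text \<open>Split \<open>v\<close> into the partial sum \<open>s\<close> over \<open>F\<close> and
  the remainder \<open>w\<close>. These are orthogonal, so by Pythagoras the two sides differ by the
  squared norm of \<open>w\<close>.\<close>

lemma Bessel_inequality:
  assumes v: "v \<in> L2" and F: "finite F"
  shows "(\<Sum>n\<in>F. (cmod (vcoeff v n))\<^sup>2) \<le> (LINT x|unit_int. (cmod (v x))\<^sup>2)"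
proof -
  define s where "s x = (\<Sum>n\<in>F. vcoeff v n * ufun n x)" for x
  define w where "w x = v x - s x" for x
  have cont_s: "continuous_on {0..1} s"
    unfolding s_def by (intro continuous_intros)
  have w: "w \<in> L2"
    using L2_add[OF v L2_cmult[OF L2_continuous[OF cont_s], of "-1"]] by (simp add: w_def[abs_def])
  note int_v = L2_integrable[OF v] and int_w = L2_integrable[OF w]
  have cnj_s: "cnj (s x) = (\<Sum>n\<in>F. cnj (vcoeff v n) * ufun (- n) x)" for x
    by (simp add: s_def cnj_ufun)
  have proj: "(LINT x|unit_int. cnj (s x) * f x) = (\<Sum>n\<in>F. cnj (vcoeff v n) * vcoeff f n)"
    if "integrable unit_int f" for f
  proof -
    have "integrable unit_int (\<lambda>x. ufun (- n) x * f x)" for n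
      by (intro integrable_unit_int_mult_continuous that continuous_intros)
    then show ?thesis
      by (simp add: cnj_s sum_distrib_right mult.assoc vcoeff_eq)
  qed
  \<comment> \<open>Orthonormality of the exponentials: \<open>s\<close> and \<open>v\<close> have
    the same coefficients on \<open>F\<close>, so those of \<open>w\<close> vanish there.\<close>
  have "vcoeff s m = vcoeff v m" if "m \<in> F" for m
  proof -
    have "vcoeff s m = (LINT x|unit_int. (\<Sum>n\<in>F. vcoeff v n * ufun (n - m) x))"
      unfolding vcoeff_eq[of s] s_def
      by (intro Bochner_Integration.integral_cong refl)
         (simp add: sum_distrib_left mult_ac ufun_add[of _ "- m", simplified])
    also have "\<dots> = (\<Sum>n\<in>F. vcoeff v n * (LINT x|unit_int. ufun (n - m) x))"
      by (subst Bochner_Integration.integral_sum)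
         (auto intro!: integrable_unit_int_continuous continuous_intros)
    also have "\<dots> = (\<Sum>n\<in>F. if n = m then vcoeff v n else 0)"
      by (intro sum.cong) (auto simp: integral_ufun)
    finally show ?thesis
      using that F by simp
  qed
  moreover have "vcoeff w m = vcoeff v m - vcoeff s m" for m
    unfolding vcoeff_eq w_def right_diff_distrib
    by (intro Bochner_Integration.integral_diff integrable_unit_int_mult_continuous int_v
        integrable_unit_int_continuous cont_s continuous_intros)
  ultimately have "vcoeff w m = 0" if "m \<in> F" for m
    using that by simp
  then have orth: "(LINT x|unit_int. cnj (s x) * w x) = 0"
    by (simp add: proj[OF int_w])
  have int1: "integrable unit_int (\<lambda>x. complex_of_real ((cmod (w x))\<^sup>2))"
    using w by (simp add: L2_def del: of_real_power)
  have int2: "integrable unit_int (\<lambda>x. cnj (cnj (s x) * w x))"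
    by (intro integrable_cnj integrable_unit_int_mult_continuous int_w continuous_intros cont_s)
  have int3: "integrable unit_int (\<lambda>x. cnj (s x) * v x)"
    by (intro integrable_unit_int_mult_continuous int_v continuous_intros cont_s)
  \<comment> \<open>The square of \<open>v = w + s\<close> is grouped so that the middle term
    integrates to the conjugate of \<open>orth\<close> and the last one falls under
    \<open>proj\<close>.\<close>
  have "complex_of_real (LINT x|unit_int. (cmod (v x))\<^sup>2)
      = (LINT x|unit_int. complex_of_real ((cmod (w x))\<^sup>2) + (cnj (cnj (s x) * w x) + cnj (s x) * v x))"
    unfolding integral_complex_of_real[symmetric]
    by (intro Bochner_Integration.integral_cong refl)
       (simp add: complex_norm_square w_def algebra_simps del: of_real_power)
  also have "\<dots> = of_real (LINT x|unit_int. (cmod (w x))\<^sup>2) + (cnj (LINT x|unit_int. cnj (s x) * w x)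
      + (LINT x|unit_int. cnj (s x) * v x))"
    using int1 int2 int3
    by (simp only: Bochner_Integration.integral_add Bochner_Integration.integrable_add
        integral_complex_of_real Bochner_Integration.integral_cnj)
  also have "\<dots> = of_real ((LINT x|unit_int. (cmod (w x))\<^sup>2) + (\<Sum>n\<in>F. (cmod (vcoeff v n))\<^sup>2))"
    unfolding orth proj[OF int_v] by (simp add: complex_norm_square mult.commute del: of_real_power)
  finally have "(LINT x|unit_int. (cmod (v x))\<^sup>2)
      = (LINT x|unit_int. (cmod (w x))\<^sup>2) + (\<Sum>n\<in>F. (cmod (vcoeff v n))\<^sup>2)"
    by (simp only: of_real_eq_iff)
  moreover have "(LINT x|unit_int. (cmod (w x))\<^sup>2) \<ge> 0"
    by simp
  ultimately show ?thesis by linarith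
qed

lemma vcoeff_square_summable:
  assumes "v \<in> L2"
  shows "(\<lambda>n. (cmod (vcoeff v n))\<^sup>2) summable_on A"
  using Bessel_inequality[OF assms]
  by (intro nonneg_bdd_above_summable_on bdd_aboveI2[where M = "LINT x|unit_int. (cmod (v x))\<^sup>2"]) auto

text \<open>The shift by 1 keeps the weight away from 0 at \<open>n = 0\<close>; the integers are
  covered by two copies of the naturals.\<close>

lemma summable_on_int_inverse_square: "(\<lambda>n::int. 1 / (1 + \<bar>real_of_int n\<bar>)\<^sup>2) summable_on A"
proof -
  have "summable (\<lambda>n. inverse (real (Suc n) ^ 2))"
    using inverse_power_summable[of 2, where 'a = real] by (subst summable_Suc_iff) simp
  then have *: "(\<lambda>n::nat. 1 / (1 + real n)\<^sup>2) summable_on UNIV"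
    by (subst summable_on_UNIV_nonneg_real_iff) (auto simp: inverse_eq_divide add.commute)
  have "(\<lambda>n::int. 1 / (1 + \<bar>real_of_int n\<bar>)\<^sup>2) summable_on range int"
    by (subst summable_on_reindex) (use * in \<open>auto simp: comp_def\<close>)
  moreover have "(\<lambda>n::int. 1 / (1 + \<bar>real_of_int n\<bar>)\<^sup>2) summable_on range (\<lambda>n. - int n)"
    by (subst summable_on_reindex) (use * in \<open>auto simp: comp_def inj_on_def\<close>)
  ultimately have "(\<lambda>n::int. 1 / (1 + \<bar>real_of_int n\<bar>)\<^sup>2) summable_on (range int \<union> range (\<lambda>n. - int n))"
    by (rule summable_on_union)
  moreover have "A \<subseteq> range int \<union> range (\<lambda>n. - int n)"
    using int_cases2 by blast
  ultimately show ?thesis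
    by (rule summable_on_subset_banach)
qed

text \<open>The Riemann-Lebesgue lemma for L2: a square summable family tends to 0 along any
  sequence of distinct indices.\<close>

lemma vcoeff_tendsto_0:
  assumes "v \<in> L2" and f: "inj f"
  shows "(\<lambda>n::nat. vcoeff v (f n)) \<longlonglongrightarrow> 0"
proof -
  have "(\<lambda>n. (cmod (vcoeff v (f n)))\<^sup>2) summable_on UNIV"
    using vcoeff_square_summable[OF assms(1), of "range f"] f
    by (subst (asm) summable_on_reindex) (auto simp: comp_def)
  then have "(\<lambda>n. (cmod (vcoeff v (f n)))\<^sup>2) \<longlonglongrightarrow> 0"
    using summable_on_imp_summable summable_LIMSEQ_zero by blast
  from tendsto_real_sqrt[OF this] show ?thesis
    by (simp add: tendsto_norm_zero_iff)
qed

section \<open>Pointwise Fourier inversion for test functions\<close>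

lemma ufun_1_eq_1_iff: "ufun 1 t = 1 \<longleftrightarrow> t \<in> \<int>"
proof -
  have "ufun 1 t = 1 \<longleftrightarrow> (\<exists>n. 2 * pi * t = of_int (2 * n) * pi)"
    by (simp add: ufun_def exp_eq_1)
  also have "\<dots> \<longleftrightarrow> (\<exists>n. t = of_int n)"
    by simp
  finally show ?thesis
    by (auto simp: Ints_def)
qed

text \<open>Integrating by parts twice gives decay of order \<open>n\<^sup>2\<close> in the
  denominator.\<close>

lemma Fourier_coefficients_test_function_summable:
  assumes "test_function \<phi>"
  shows "(\<lambda>n. cmod (LINT x|unit_int. ufun n x * of_real (\<phi> x))) summable_on A"
proof -
  let ?P = "\<lambda>n. LINT x|unit_int. ufun n x * of_real (\<phi> x)"
  \<comment> \<open>The L1 norm of the second derivative handles all \<open>n \<noteq> 0\<close>;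
    the extra summand handles \<open>n = 0\<close>, where integration by parts gives
    nothing.\<close>
  define C where "C = (LINT x|unit_int. \<bar>(deriv ^^ 2) \<phi> x\<bar>) + cmod (?P 0)"
  have *: "cmod (?P n) \<le> C * (1 / (1 + \<bar>real_of_int n\<bar>)\<^sup>2)" for n
  proof (cases "n = 0")
    case True
    then show ?thesis by (simp add: C_def)
  next
    case False
    have "(2 * pi * \<bar>real_of_int n\<bar>)\<^sup>2 * cmod (?P n) = cmod ((- freq n) ^ 2 * ?P n)"
      by (simp add: norm_mult norm_power norm_freq)
    also have "\<dots> = cmod (LINT x|unit_int. ufun n x * of_real ((deriv ^^ 2) \<phi> x))"
      by (simp only: integral_ufun_test_function_derivs[OF assms])
    also have "\<dots> \<le> (LINT x|unit_int. cmod (ufun n x * of_real ((deriv ^^ 2) \<phi> x)))"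
      by (rule integral_norm_bound)
    also have "\<dots> = (LINT x|unit_int. \<bar>(deriv ^^ 2) \<phi> x\<bar>)"
      by (simp only: norm_mult norm_ufun norm_of_real mult_1)
    also have "\<dots> \<le> C"
      by (simp add: C_def)
    finally have "(2 * pi * \<bar>real_of_int n\<bar>)\<^sup>2 * cmod (?P n) \<le> C" .
    moreover have "1 + \<bar>real_of_int n\<bar> \<le> 2 * pi * \<bar>real_of_int n\<bar>"
    proof -
      have "1 \<le> \<bar>real_of_int n\<bar>"
        using False by linarith
      moreover have "2 * \<bar>real_of_int n\<bar> \<le> 2 * pi * \<bar>real_of_int n\<bar>"
        using pi_ge_two by (intro mult_right_mono) auto
      ultimately show ?thesis by linarith
    qed
    then have "(1 + \<bar>real_of_int n\<bar>)\<^sup>2 * cmod (?P n) \<le> (2 * pi * \<bar>real_of_int n\<bar>)\<^sup>2 * cmod (?P n)"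
      by (intro mult_right_mono power_mono) auto
    ultimately have "(1 + \<bar>real_of_int n\<bar>)\<^sup>2 * cmod (?P n) \<le> C"
      by linarith
    then show ?thesis
      by (simp add: pos_le_divide_eq mult.commute)
  qed
  show ?thesis
    by (rule Infinite_Sum.abs_summable_on_comparison_test'[OF _ *])
       (intro summable_on_cmult_right summable_on_int_inverse_square)
qed

text \<open>The quotient has a removable singularity at \<open>x0\<close>, because the denominator
  \<open>ufun 1 (x - x0) - 1\<close> has a simple zero there and no other zero on the closed
  interval.\<close>

lemma test_function_difference_quotient:
  assumes "test_function \<phi>" and x0: "x0 \<in> {0<..<1}"
  obtains h where "continuous_on {0..1} h"
    "\<And>x. x \<in> {0..1} \<Longrightarrow> of_real (\<phi> x) = of_real (\<phi> x0) + (ufun 1 (x - x0) - 1) * h x"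
proof
  \<comment> \<open>The value given by l'Hopital's rule: the ratio of the derivatives of numerator
    and denominator at \<open>x0\<close>.\<close>
  define D where "D = of_real (deriv \<phi> x0) / freq 1"
  define q where "q x = of_real (\<phi> x - \<phi> x0) / (ufun 1 (x - x0) - 1)" for x
  define h where "h x = (if x = x0 then D else q x)" for x
  \<comment> \<open>The denominator vanishes only if \<open>x - x0\<close> is an integer; since
    \<open>x0\<close> is interior, every point of the closed interval is at distance less than 1
    from it.\<close>
  have nz: "ufun 1 (x - x0) \<noteq> 1" if "x \<in> {x0 - 1<..<x0 + 1} - {x0}" for x
  proof -
    have "\<bar>x - x0\<bar> < 1" "x - x0 \<noteq> 0"
      using that by auto
    then show ?thesis
      unfolding ufun_1_eq_1_iff using Ints_nonzero_abs_less1 by blast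
  qed
  have lim: "q \<midarrow>x0\<rightarrow> D"
  proof -
    have "((\<lambda>x. (\<phi> x - \<phi> x0) / (x - x0)) \<longlongrightarrow> deriv \<phi> x0) (at x0)"
      using test_function_derivs[OF assms(1), of 0 x0 UNIV] by (simp add: has_field_derivative_iff)
    then have 1: "((\<lambda>x. complex_of_real ((\<phi> x - \<phi> x0) / (x - x0))) \<longlongrightarrow> of_real (deriv \<phi> x0)) (at x0)"
      by (rule tendsto_of_real)
    have "((\<lambda>z. exp (freq 1 * z)) has_field_derivative freq 1) (at 0)"
      by (auto intro!: derivative_eq_intros)
    then have "((\<lambda>z. (exp (freq 1 * z) - 1) / z) \<longlongrightarrow> freq 1) (at 0)"
      by (simp add: has_field_derivative_iff)
    moreover have "filterlim (\<lambda>x. complex_of_real (x - x0)) (at 0) (at x0)"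
    proof (rule filterlim_atI)
      have "((\<lambda>x. complex_of_real (x - x0)) \<longlongrightarrow> of_real (x0 - x0)) (at x0)"
        by (intro tendsto_intros)
      then show "((\<lambda>x. complex_of_real (x - x0)) \<longlongrightarrow> 0) (at x0)"
        by simp
      show "\<forall>\<^sub>F x in at x0. complex_of_real (x - x0) \<noteq> 0"
        by (auto simp: eventually_at_filter)
    qed
    ultimately have 2: "((\<lambda>x. (ufun 1 (x - x0) - 1) / of_real (x - x0)) \<longlongrightarrow> freq 1) (at x0)"
      unfolding ufun_eq by (rule filterlim_compose)
    have "((\<lambda>x. of_real ((\<phi> x - \<phi> x0) / (x - x0)) / ((ufun 1 (x - x0) - 1) / of_real (x - x0)))
        \<longlongrightarrow> D) (at x0)"
      unfolding D_def by (rule tendsto_divide[OF 1 2]) simp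
    then show ?thesis
      by (rule Lim_transform_eventually) (auto simp: eventually_at_filter q_def)
  qed
  show "continuous_on {0..1} h"
  proof (rule continuous_at_imp_continuous_on, rule ballI)
    fix x :: real assume "x \<in> {0..1}"
    then have x: "x \<in> {x0 - 1<..<x0 + 1}"
      using x0 by auto
    show "isCont h x"
    proof (cases "x = x0")
      case True
      have "\<forall>\<^sub>F x in at x0. q x = h x"
        by (auto simp: h_def eventually_at_filter)
      with lim have "h \<midarrow>x0\<rightarrow> D"
        by (rule Lim_transform_eventually)
      then show ?thesis
        using True by (simp add: isCont_def h_def)
    next
      case False
      have "continuous_on ({x0 - 1<..<x0 + 1} - {x0}) q"
        unfolding q_def
        by (intro continuous_intros continuous_on_test_function_derivs[OF assms(1), of _ 0, simplified]
            continuous_on_compose2[OF continuous_on_ufun[of UNIV]])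
           (use nz in auto)
      then have "continuous_on ({x0 - 1<..<x0 + 1} - {x0}) h"
        by (rule continuous_on_eq) (auto simp: h_def)
      then show ?thesis
        using x False by (subst (asm) continuous_on_eq_continuous_at) (auto intro!: open_Diff)
    qed
  qed
  fix x :: real assume "x \<in> {0..1}"
  then show "of_real (\<phi> x) = of_real (\<phi> x0) + (ufun 1 (x - x0) - 1) * h x"
    using nz[of x] x0 by (cases "x = x0") (auto simp: h_def q_def)
qed

lemma sum_telescope_int:
  fixes a :: "int \<Rightarrow> 'a::ab_group_add"
  shows "(\<Sum>n\<in>{- int N..int N}. a (n - 1) - a n) = a (- int N - 1) - a (int N)"
proof (induction N)
  case (Suc N)
  have "{- int (Suc N)..int (Suc N)} = insert (- int N - 1) (insert (int N + 1) {- int N..int N})"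
    by auto
  then show ?case
    using Suc by (simp add: algebra_simps)
qed simp

text \<open>Allows the value of an unconditionally convergent sum over the integers to be read off
  from its symmetric partial sums.\<close>

lemma filterlim_symmetric_intervals:
  "filterlim (\<lambda>N. {- int N..int N}) (finite_subsets_at_top UNIV) sequentially"
proof (rule filterlim_finite_subsets_at_top[THEN iffD2], intro allI impI)
  fix X :: "int set" assume "finite X \<and> X \<subseteq> UNIV"
  then have "finite ((\<lambda>n. nat \<bar>n\<bar>) ` X)"
    by simp
  then obtain M where M: "\<forall>k\<in>(\<lambda>n. nat \<bar>n\<bar>) ` X. k \<le> M"
    using finite_nat_set_iff_bounded_le by blast
  show "\<forall>\<^sub>F N in sequentially. finite {- int N..int N} \<and> X \<subseteq> {- int N..int N} \<and> {- int N..int N} \<subseteq> UNIV"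
    using eventually_ge_at_top[of M]
  proof eventually_elim
    case (elim N)
    then show ?case
      using M by fastforce
  qed
qed

text \<open>Chernoff's argument: division by \<open>ufun 1 (x - x0) - 1\<close> makes the partial sums telescope,
  and what remains are two Fourier coefficients of the continuous quotient.\<close>

lemma Fourier_series_test_function:
  assumes "test_function \<phi>" and x0: "x0 \<in> {0<..<1}"
  shows "((\<lambda>n. (LINT x|unit_int. ufun (- n) x * of_real (\<phi> x)) * ufun n x0) has_sum of_real (\<phi> x0)) UNIV"
proof -
  obtain h where h: "continuous_on {0..1} h"
    "\<And>x. x \<in> {0..1} \<Longrightarrow> of_real (\<phi> x) = of_real (\<phi> x0) + (ufun 1 (x - x0) - 1) * h x"
    using test_function_difference_quotient[OF assms] by blast
  define P where "P n = (LINT x|unit_int. ufun (- n) x * of_real (\<phi> x))" for n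
  define a where "a n = ufun n x0 * vcoeff h n" for n
  \<comment> \<open>The constant \<open>\<phi> x0\<close> contributes only to the coefficient with
    \<open>n = 0\<close>. Multiplying \<open>h\<close> by \<open>ufun 1 (x - x0)\<close> shifts its
    coefficient index by one, which produces the difference.\<close>
  have "P n * ufun n x0 = (if n = 0 then of_real (\<phi> x0) else 0) + (a (n - 1) - a n)" for n
  proof -
    let ?I = "\<lambda>n. LINT x|unit_int. ufun n x * h x"
    have int: "integrable unit_int (\<lambda>x. ufun n x * h x)" for n
      by (intro integrable_unit_int_continuous continuous_intros h)
    have "P n = (LINT x|unit_int. of_real (\<phi> x0) * ufun (- n) x
        + (ufun (- 1) x0 * (ufun (- (n - 1)) x * h x) - ufun (- n) x * h x))"
      unfolding P_def
    proof (rule Bochner_Integration.integral_cong[OF refl])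
      fix x assume "x \<in> space unit_int"
      then have "ufun (- n) x * of_real (\<phi> x)
          = ufun (- n) x * (of_real (\<phi> x0) + (ufun 1 x * ufun (- 1) x0 - 1) * h x)"
        using h(2)[of x] by (simp add: ufun_diff_arg)
      also have "\<dots> = of_real (\<phi> x0) * ufun (- n) x
          + (ufun (- 1) x0 * ((ufun (- n) x * ufun 1 x) * h x) - ufun (- n) x * h x)"
        by (simp add: algebra_simps)
      also have "ufun (- n) x * ufun 1 x = ufun (- (n - 1)) x"
        by (simp flip: ufun_add)
      finally show "ufun (- n) x * of_real (\<phi> x) = of_real (\<phi> x0) * ufun (- n) x
          + (ufun (- 1) x0 * (ufun (- (n - 1)) x * h x) - ufun (- n) x * h x)" .
    qed
    also have "\<dots> = (LINT x|unit_int. of_real (\<phi> x0) * ufun (- n) x)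
        + ((LINT x|unit_int. ufun (- 1) x0 * (ufun (- (n - 1)) x * h x)) - ?I (- n))"
    proof -
      have "integrable unit_int (\<lambda>x. of_real (\<phi> x0) * ufun (- n) x)"
        by (intro integrable_unit_int_continuous continuous_intros)
      moreover have "integrable unit_int (\<lambda>x. ufun (- 1) x0 * (ufun (- (n - 1)) x * h x))"
        by (intro integrable_mult_right int)
      ultimately show ?thesis
        using int[of "- n"] by (simp only: Bochner_Integration.integral_add
            Bochner_Integration.integral_diff Bochner_Integration.integrable_diff)
    qed
    also have "\<dots> = of_real (\<phi> x0) * (if n = 0 then 1 else 0) + (ufun (- 1) x0 * vcoeff h (n - 1) - vcoeff h n)"
      by (simp only: integral_mult_right_zero integral_ufun vcoeff_eq neg_equal_0_iff_equal)
    finally have "P n * ufun n x0 = (of_real (\<phi> x0) * (if n = 0 then 1 else 0)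
        + (ufun (- 1) x0 * vcoeff h (n - 1) - vcoeff h n)) * ufun n x0"
      by (rule arg_cong)
    also have "\<dots> = of_real (\<phi> x0) * (if n = 0 then 1 else 0) * ufun n x0
        + ((ufun n x0 * ufun (- 1) x0) * vcoeff h (n - 1) - ufun n x0 * vcoeff h n)"
      by (simp only: algebra_simps)
    also have "ufun n x0 * ufun (- 1) x0 = ufun (n - 1) x0"
      by (simp flip: ufun_add)
    finally show ?thesis
      by (auto simp: a_def)
  qed
  then have partial: "(\<Sum>n\<in>{- int N..int N}. P n * ufun n x0) = of_real (\<phi> x0) + (a (- int N - 1) - a (int N))" for N
    by (simp add: sum.distrib sum_telescope_int)
  have h_L2: "h \<in> L2"
    by (rule L2_continuous[OF h(1)])
  have "(\<lambda>N. a (f N)) \<longlonglongrightarrow> 0" if "inj f" for f :: "nat \<Rightarrow> int"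
  proof (rule tendsto_norm_zero_cancel)
    show "(\<lambda>N. cmod (a (f N))) \<longlonglongrightarrow> 0"
      using tendsto_norm_zero[OF vcoeff_tendsto_0[OF h_L2 that]] by (simp add: a_def norm_mult)
  qed
  from this[of "\<lambda>N. - int N - 1"] this[of int]
  have "(\<lambda>N. a (- int N - 1)) \<longlonglongrightarrow> 0" "(\<lambda>N. a (int N)) \<longlonglongrightarrow> 0"
    by (simp_all add: inj_on_def)
  then have "(\<lambda>N. of_real (\<phi> x0) + (a (- int N - 1) - a (int N))) \<longlonglongrightarrow> of_real (\<phi> x0) + (0 - 0)"
    by (intro tendsto_intros)
  then have lim: "(\<lambda>N. \<Sum>n\<in>{- int N..int N}. P n * ufun n x0) \<longlonglongrightarrow> of_real (\<phi> x0)"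
    by (simp add: partial)
  \<comment> \<open>Telescoping yields only the limit of the symmetric sums; absolute summability
    turns it into the unconditional sum.\<close>
  have "(\<lambda>n. cmod (P n)) summable_on UNIV"
    using Fourier_coefficients_test_function_summable[OF assms(1), of "range uminus"]
    by (subst (asm) summable_on_reindex) (auto simp: comp_def P_def)
  then have "(\<lambda>n. cmod (P n * ufun n x0)) summable_on UNIV"
    by (simp add: norm_mult)
  then have "(\<lambda>n. P n * ufun n x0) summable_on UNIV"
    by (rule abs_summable_summable)
  then have hs: "((\<lambda>n. P n * ufun n x0) has_sum (\<Sum>\<^sub>\<infinity>n. P n * ufun n x0)) UNIV"
    by (rule has_sum_infsum)
  then have "(\<lambda>N. \<Sum>n\<in>{- int N..int N}. P n * ufun n x0) \<longlonglongrightarrow> (\<Sum>\<^sub>\<infinity>n. P n * ufun n x0)"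
    unfolding has_sum_def by (rule filterlim_compose[OF _ filterlim_symmetric_intervals])
  then have "(\<Sum>\<^sub>\<infinity>n. P n * ufun n x0) = of_real (\<phi> x0)"
    using lim LIMSEQ_unique by blast
  with hs show ?thesis
    by (simp add: P_def)
qed

text \<open>The expanded factor is the test function, not \<open>v\<close>: its Fourier series
  converges absolutely, so it may be integrated termwise against \<open>v\<close>.\<close>

lemma Parseval_test_function:
  assumes v: "v \<in> L2" and \<phi>: "test_function \<phi>"
  shows "((\<lambda>n. vcoeff v n * (LINT x|unit_int. ufun n x * of_real (\<phi> x))) has_sum
     (LINT x|unit_int. v x * of_real (\<phi> x))) UNIV"
proof -
  let ?P = "\<lambda>n. LINT x|unit_int. ufun n x * of_real (\<phi> x)"
  \<comment> \<open>\<open>?P (- n)\<close> is the Fourier coefficient of the test function at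
    \<open>n\<close>, while \<open>ufun n\<close> paired with \<open>v\<close> gives
    \<open>vcoeff v (- n)\<close>; the final reindexing by \<open>uminus\<close> undoes both
    signs.\<close>
  have "(\<lambda>n. cmod (?P (- n))) summable_on UNIV"
    using Fourier_coefficients_test_function_summable[OF \<phi>, of "range uminus"]
    by (subst (asm) summable_on_reindex) (auto simp: comp_def)
  from ufun_series_integral[OF this L2_integrable[OF v]]
  have "((\<lambda>n. ?P (- n) * vcoeff v (- n)) has_sum
      (LINT x|unit_int. (\<Sum>\<^sub>\<infinity>n. ?P (- n) * ufun n x) * v x)) UNIV"
    by (simp add: vcoeff_eq)
  also have "(LINT x|unit_int. (\<Sum>\<^sub>\<infinity>n. ?P (- n) * ufun n x) * v x) = (LINT x|unit_int. v x * of_real (\<phi> x))"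
  proof (rule Bochner_Integration.integral_cong[OF refl])
    fix x assume "x \<in> space unit_int"
    then have "(\<Sum>\<^sub>\<infinity>n. ?P (- n) * ufun n x) = of_real (\<phi> x)"
      using infsumI[OF Fourier_series_test_function[OF \<phi>]] by simp
    then show "(\<Sum>\<^sub>\<infinity>n. ?P (- n) * ufun n x) * v x = v x * of_real (\<phi> x)"
      by simp
  qed
  finally have "((\<lambda>n. vcoeff v n * ?P n) has_sum (LINT x|unit_int. v x * of_real (\<phi> x))) (range uminus)"
    by (subst has_sum_reindex) (auto simp: comp_def mult.commute)
  then show ?thesis by simp
qed

subsection \<open>Resolvent series\<close>

text \<open>The real cube is injective, so the eigenvalues \<open>zev n\<close> are distinct and
  membership of \<open>zev n\<close> in \<open>sigma0 v\<close> or \<open>sigma1 v\<close> is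
  decided by \<open>vcoeff v n\<close> alone.\<close>

lemma zev_eq_iff [simp]: "zev m = zev n \<longleftrightarrow> m = n"
proof
  assume "zev m = zev n"
  then have "(2 * of_int m * pi) ^ 3 = (2 * of_int n * pi) ^ 3"
    unfolding zev_def of_real_eq_iff .
  then have "root 3 ((2 * of_int m * pi) ^ 3) = root 3 ((2 * of_int n * pi) ^ 3)"
    by (rule arg_cong)
  then show "m = n"
    by (simp add: odd_real_root_power_cancel)
qed simp

lemma norm_zev_ge: "\<bar>real_of_int n\<bar> ^ 3 \<le> cmod (zev n)"
proof -
  have "1 * \<bar>real_of_int n\<bar> \<le> 2 * pi * \<bar>real_of_int n\<bar>"
    using pi_ge_two by (intro mult_right_mono) auto
  then have "\<bar>real_of_int n\<bar> ^ 3 \<le> (2 * pi * \<bar>real_of_int n\<bar>) ^ 3"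
    by (intro power_mono) auto
  also have "\<dots> = cmod (zev n)"
    unfolding zev_def norm_of_real by (simp add: power_abs abs_mult mult_ac)
  finally show ?thesis .
qed

lemma zev_in_sigma0_iff: "zev n \<in> sigma0 v \<longleftrightarrow> vcoeff v n = 0"
  by (auto simp: sigma0_def)

lemma zev_in_sigma1_iff: "zev n \<in> sigma1 v \<longleftrightarrow> vcoeff v n \<noteq> 0"
  by (auto simp: sigma1_def)

text \<open>For large |n| the cubic growth of \<open>zev n\<close> outweighs \<open>\<mu>\<close>;
  the finitely many other indices in \<open>S\<close> each have a positive ratio because
  \<open>\<mu>\<close> is none of their \<open>zev n\<close>.\<close>

lemma zev_cubic_separation:
  assumes "\<mu> \<notin> zev ` S"
  obtains c where "c > 0" "\<And>n. n \<in> S \<Longrightarrow> c * (1 + \<bar>real_of_int n\<bar>) ^ 3 \<le> cmod (zev n - \<mu>)"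
proof
  \<comment> \<open>Beyond this bound |n| is at least 1 and \<open>2 * cmod \<mu>\<close> is at most
    |n|, hence at most |n|^3.\<close>
  define N where "N = max 1 \<lceil>2 * cmod \<mu>\<rceil>"
  define F where "F = S \<inter> {- N..N}"
  define r where "r n = cmod (zev n - \<mu>) / (1 + \<bar>real_of_int n\<bar>) ^ 3" for n
  \<comment> \<open>Outside \<open>F\<close> the distance is at least |n|^3 / 2, and (1 + |n|)^3 is
    at most 8 |n|^3, hence 1 / 16. Inserting it also keeps the minimum defined when \<open>F\<close>
    is empty.\<close>
  define c where "c = Min (insert (1 / 16) (r ` F))"
  have F: "finite F"
    by (simp add: F_def)
  have "r n > 0" if "n \<in> S" for n
    using assms that by (auto simp: r_def intro!: divide_pos_pos)
  then show "c > 0"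
    using F by (auto simp: c_def F_def)
  fix n assume n: "n \<in> S"
  have "c \<le> r n"
  proof (cases "n \<in> F")
    case True
    then show ?thesis
      using F by (simp add: c_def)
  next
    case False
    then have "\<bar>n\<bar> > N"
      using n by (auto simp: F_def)
    then have n1: "\<bar>real_of_int n\<bar> \<ge> 1" and n2: "2 * cmod \<mu> \<le> \<bar>real_of_int n\<bar>"
      unfolding N_def by linarith+
    have "\<bar>real_of_int n\<bar> ^ 1 \<le> \<bar>real_of_int n\<bar> ^ 3"
      using n1 by (intro power_increasing) auto
    then have "\<bar>real_of_int n\<bar> ^ 3 / 2 \<le> \<bar>real_of_int n\<bar> ^ 3 - cmod \<mu>"
      using n2 by simp
    also have "\<dots> \<le> cmod (zev n) - cmod \<mu>"
      using norm_zev_ge by simp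
    also have "\<dots> \<le> cmod (zev n - \<mu>)"
      by (rule norm_triangle_ineq2)
    finally have 1: "\<bar>real_of_int n\<bar> ^ 3 / 2 \<le> cmod (zev n - \<mu>)" .
    have "(1 + \<bar>real_of_int n\<bar>) ^ 3 \<le> (2 * \<bar>real_of_int n\<bar>) ^ 3"
      using n1 by (intro power_mono) auto
    with 1 have "1 / 16 * (1 + \<bar>real_of_int n\<bar>) ^ 3 \<le> cmod (zev n - \<mu>)"
      by (simp add: power_mult_distrib)
    then have "1 / 16 \<le> r n"
      unfolding r_def by (subst pos_le_divide_eq) auto
    moreover have "c \<le> 1 / 16"
      unfolding c_def using F by (intro Min_le) auto
    ultimately show ?thesis by linarith
  qed
  then show "c * (1 + \<bar>real_of_int n\<bar>) ^ 3 \<le> cmod (zev n - \<mu>)"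
    unfolding r_def by (subst (asm) pos_le_divide_eq) auto
qed

text \<open>The power of \<open>freq n\<close> grows at most quadratically and the denominator at
  least cubically. This leaves a factor 1 / (1 + |n|) beside \<open>vcoeff v n\<close>, and both are
  square summable. At \<open>k = 3\<close> no such factor would be left.\<close>

lemma resolvent_coefficients_summable:
  assumes v: "v \<in> L2" and \<mu>: "\<mu> \<notin> zev ` S" and k: "k \<le> 2"
  shows "(\<lambda>n. cmod (freq n ^ k * (vcoeff v n / (zev n - \<mu>)))) summable_on S"
proof -
  obtain c where c: "c > 0" "\<And>n. n \<in> S \<Longrightarrow> c * (1 + \<bar>real_of_int n\<bar>) ^ 3 \<le> cmod (zev n - \<mu>)"
    using zev_cubic_separation[OF \<mu>] by blast
  show ?thesis
  proof (rule Infinite_Sum.abs_summable_on_comparison_test')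
    show "(\<lambda>n. (2 * pi) ^ 2 / c * ((cmod (vcoeff v n))\<^sup>2 + 1 / (1 + \<bar>real_of_int n\<bar>)\<^sup>2)) summable_on S"
      by (intro summable_on_cmult_right summable_on_add vcoeff_square_summable v
          summable_on_int_inverse_square)
    fix n assume n: "n \<in> S"
    define t where "t = 1 + \<bar>real_of_int n\<bar>"
    define b where "b = cmod (vcoeff v n)"
    have t: "t \<ge> 1" and b: "b \<ge> 0"
      by (simp_all add: t_def b_def)
    have "cmod (freq n) ^ k \<le> (2 * pi * t) ^ k"
      by (intro power_mono) (auto simp: norm_freq t_def)
    also have "\<dots> \<le> (2 * pi * t) ^ 2"
    proof (rule power_increasing[OF k])
      have "1 * 1 \<le> 2 * pi * t"
        using pi_ge_two t by (intro mult_mono) auto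
      then show "1 \<le> 2 * pi * t" by simp
    qed
    finally have 1: "cmod (freq n) ^ k \<le> (2 * pi * t) ^ 2" .
    have "0 < c * t ^ 3"
      using c(1) t by simp
    then have "b / cmod (zev n - \<mu>) \<le> b / (c * t ^ 3)"
      using c(2)[OF n] b unfolding t_def by (intro divide_left_mono) (auto intro!: mult_pos_pos)
    then have "cmod (freq n) ^ k * (b / cmod (zev n - \<mu>)) \<le> (2 * pi * t) ^ 2 * (b / (c * t ^ 3))"
      using 1 b by (intro mult_mono) auto
    also have "\<dots> = (2 * pi) ^ 2 / c * (b * (1 / t))"
      using t c(1) by (simp add: field_simps power2_eq_square power3_eq_cube)
    \<comment> \<open>A product of two nonnegative numbers is at most the sum of their
      squares.\<close>
    also have "\<dots> \<le> (2 * pi) ^ 2 / c * (b\<^sup>2 + (1 / t)\<^sup>2)"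
    proof (intro mult_left_mono)
      have "0 \<le> (b - 1 / t)\<^sup>2" "0 \<le> b * (1 / t)"
        using b t by auto
      then show "b * (1 / t) \<le> b\<^sup>2 + (1 / t)\<^sup>2"
        unfolding power2_diff by linarith
    qed (use c(1) in auto)
    finally show "cmod (freq n ^ k * (vcoeff v n / (zev n - \<mu>)))
        \<le> (2 * pi) ^ 2 / c * ((cmod (vcoeff v n))\<^sup>2 + 1 / (1 + \<bar>real_of_int n\<bar>)\<^sup>2)"
      by (simp add: norm_mult norm_power norm_divide b_def t_def power_one_over)
  qed
qed

text \<open>Paired termwise with a test function, both sides become the same series:
  \<open>(- freq n) ^ k\<close> from integration by parts equals
  \<open>(-1) ^ k * freq n ^ k\<close>.\<close>

lemma weak_deriv_ufun_series:
  assumes a: "(\<lambda>n. cmod (a n)) summable_on A" and ak: "(\<lambda>n. cmod (freq n ^ k * a n)) summable_on A"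
  shows "weak_deriv k (\<lambda>x. \<Sum>\<^sub>\<infinity>n\<in>A. a n * ufun n x) (\<lambda>x. \<Sum>\<^sub>\<infinity>n\<in>A. (freq n ^ k * a n) * ufun n x)"
  unfolding weak_deriv_def
proof (intro allI impI)
  fix \<phi> assume \<phi>: "test_function \<phi>"
  let ?D = "\<lambda>k x. of_real ((deriv ^^ k) \<phi> x) :: complex"
  let ?P = "\<lambda>n. LINT x|unit_int. ufun n x * of_real (\<phi> x)"
  have int: "integrable unit_int (?D k)" for k
    by (intro integrable_unit_int_continuous continuous_intros continuous_on_test_function_derivs \<phi>)
  have lhs: "((\<lambda>n. a n * ((- freq n) ^ k * ?P n)) has_sum
      (LINT x|unit_int. (\<Sum>\<^sub>\<infinity>n\<in>A. a n * ufun n x) * ?D k x)) A"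
    using ufun_series_integral[OF a int[of k]] by (simp only: integral_ufun_test_function_derivs[OF \<phi>])
  have rhs: "((\<lambda>n. (-1) ^ k * ((freq n ^ k * a n) * ?P n)) has_sum
      ((-1) ^ k * (LINT x|unit_int. (\<Sum>\<^sub>\<infinity>n\<in>A. (freq n ^ k * a n) * ufun n x) * of_real (\<phi> x)))) A"
    using ufun_series_integral[OF ak int[of 0]] by (intro has_sum_cmult_right) simp
  have eq: "(\<lambda>n. a n * ((- freq n) ^ k * ?P n)) = (\<lambda>n. (-1) ^ k * ((freq n ^ k * a n) * ?P n))"
    by (subst power_minus) (simp only: mult_ac)
  show "(LINT x|unit_int. (\<Sum>\<^sub>\<infinity>n\<in>A. a n * ufun n x) * ?D k x)
      = (-1) ^ k * (LINT x|unit_int. (\<Sum>\<^sub>\<infinity>n\<in>A. (freq n ^ k * a n) * ufun n x) * of_real (\<phi> x))"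
    by (rule has_sum_unique[OF lhs[unfolded eq] rhs])
qed

lemma weak_deriv_ufun: "weak_deriv k (ufun n) (\<lambda>x. freq n ^ k * ufun n x)"
  using weak_deriv_ufun_series[of "\<lambda>_. 1" "{n}" k] by simp

text \<open>With \<open>a = z n - \<mu>\<close> and \<open>h = \<zeta> - \<mu>\<close>, sum the
  identity 1/(a - h) = 1/a + h/a^2 + h^2/(a^2 (a - h)) with weights \<open>w n\<close>. The error of
  the difference quotient is then \<open>h\<close> times a series that stays bounded near
  \<open>\<mu>\<close>.\<close>

lemma has_field_derivative_Cauchy_transform:
  fixes z :: "'a \<Rightarrow> complex"
  assumes w: "w summable_on S" "\<And>n. n \<in> S \<Longrightarrow> w n \<ge> 0"
    and d: "d > 0" "\<And>n. n \<in> S \<Longrightarrow> d \<le> cmod (z n - \<mu>)"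
  shows "((\<lambda>\<zeta>. \<Sum>\<^sub>\<infinity>n\<in>S. of_real (w n) / (z n - \<zeta>)) has_field_derivative
      (\<Sum>\<^sub>\<infinity>n\<in>S. of_real (w n) / (z n - \<mu>)\<^sup>2)) (at \<mu>)"
proof -
  let ?g = "\<lambda>\<zeta>. \<Sum>\<^sub>\<infinity>n\<in>S. of_real (w n) / (z n - \<zeta>)"
  let ?D = "\<Sum>\<^sub>\<infinity>n\<in>S. of_real (w n) / (z n - \<mu>)\<^sup>2"
  let ?R = "\<lambda>\<zeta>. \<Sum>\<^sub>\<infinity>n\<in>S. of_real (w n) / ((z n - \<mu>)\<^sup>2 * (z n - \<zeta>))"
  \<comment> \<open>Bounds the remainder series for |h| < d / 2, where \<open>z n\<close> is at
    distance at least \<open>d\<close> from \<open>\<mu>\<close> and at least \<open>d / 2\<close>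
    from \<open>\<zeta>\<close>.\<close>
  define C where "C = (\<Sum>\<^sub>\<infinity>n\<in>S. w n * (2 / d ^ 3))"
  have abs_summable: "(\<lambda>n. cmod (of_real (w n) / q n)) summable_on S"
    if "e > 0" "\<And>n. n \<in> S \<Longrightarrow> e \<le> cmod (q n)" for e q
  proof (rule Infinite_Sum.abs_summable_on_comparison_test')
    show "(\<lambda>n. w n * (1 / e)) summable_on S"
      by (intro summable_on_cmult_left w)
    fix n assume n: "n \<in> S"
    have "w n / cmod (q n) \<le> w n / e"
      using that(1) that(2)[OF n] w(2)[OF n] by (intro divide_left_mono mult_pos_pos) linarith+
    then show "cmod (of_real (w n) / q n) \<le> w n * (1 / e)"
      using w(2)[OF n] by (simp add: norm_divide)
  qed
  have bound: "cmod ((?g \<zeta> - ?g \<mu>) / (\<zeta> - \<mu>) - ?D) \<le> cmod (\<zeta> - \<mu>) * C"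
    if \<zeta>: "dist \<zeta> \<mu> < d / 2" "\<zeta> \<noteq> \<mu>" for \<zeta>
  proof -
    define h where "h = \<zeta> - \<mu>"
    have h: "h \<noteq> 0" "cmod h < d / 2"
      using \<zeta> by (auto simp: h_def dist_norm)
    have far: "d / 2 \<le> cmod (z n - \<zeta>)" if "n \<in> S" for n
    proof -
      have "cmod (z n - \<mu>) - cmod h \<le> cmod ((z n - \<mu>) - h)"
        by (rule norm_triangle_ineq2)
      then show ?thesis
        using d(2)[OF that] h(2) unfolding h_def by simp
    qed
    have far2: "d\<^sup>2 \<le> cmod ((z n - \<mu>)\<^sup>2)" if "n \<in> S" for n
      using d that by (auto simp: norm_power intro!: power_mono)
    have far3: "d ^ 3 / 2 \<le> cmod ((z n - \<mu>)\<^sup>2 * (z n - \<zeta>))" if "n \<in> S" for n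
    proof -
      have "d\<^sup>2 * (d / 2) \<le> cmod ((z n - \<mu>)\<^sup>2) * cmod (z n - \<zeta>)"
        using far far2 that d(1) by (intro mult_mono) auto
      then show ?thesis
        by (simp add: norm_mult power2_eq_square power3_eq_cube)
    qed
    have sR: "(\<lambda>n. cmod (of_real (w n) / ((z n - \<mu>)\<^sup>2 * (z n - \<zeta>)))) summable_on S"
      by (rule abs_summable[of "d ^ 3 / 2"]) (use d(1) far3 in simp_all)
    have s1: "(\<lambda>n. cmod (of_real (w n) / (z n - \<mu>))) summable_on S"
      by (rule abs_summable[OF d])
    have s2: "(\<lambda>n. cmod (of_real (w n) / (z n - \<mu>)\<^sup>2)) summable_on S"
      by (rule abs_summable[of "d\<^sup>2"]) (use d(1) far2 in simp_all)
    have "((\<lambda>n. of_real (w n) / (z n - \<mu>) + h * (of_real (w n) / (z n - \<mu>)\<^sup>2)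
        + h\<^sup>2 * (of_real (w n) / ((z n - \<mu>)\<^sup>2 * (z n - \<zeta>)))) has_sum (?g \<mu> + h * ?D + h\<^sup>2 * ?R \<zeta>)) S"
      by (intro has_sum_add has_sum_cmult_right has_sum_infsum s1[THEN abs_summable_summable]
          s2[THEN abs_summable_summable] sR[THEN abs_summable_summable])
    moreover have "of_real (w n) / (z n - \<mu>) + h * (of_real (w n) / (z n - \<mu>)\<^sup>2)
        + h\<^sup>2 * (of_real (w n) / ((z n - \<mu>)\<^sup>2 * (z n - \<zeta>))) = of_real (w n) / (z n - \<zeta>)"
      if "n \<in> S" for n
    proof -
      define a where "a = z n - \<mu>"
      have "a \<noteq> 0" "a - h \<noteq> 0"
        using d(1) d(2)[OF that] far[OF that] by (auto simp: a_def h_def)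
      moreover have "z n - \<zeta> = a - h"
        by (simp add: a_def h_def)
      ultimately show ?thesis
        unfolding a_def[symmetric] by (simp add: divide_simps) (simp add: algebra_simps power2_eq_square)
    qed
    ultimately have "((\<lambda>n. of_real (w n) / (z n - \<zeta>)) has_sum (?g \<mu> + h * ?D + h\<^sup>2 * ?R \<zeta>)) S"
      by (subst (asm) has_sum_cong) auto
    then have "?g \<zeta> = ?g \<mu> + h * ?D + h\<^sup>2 * ?R \<zeta>"
      by (rule infsumI)
    then have "(?g \<zeta> - ?g \<mu>) / h - ?D = h * ?R \<zeta>"
      using h(1) by (simp add: field_simps power2_eq_square)
    moreover have "cmod (?R \<zeta>) \<le> C"
    proof -
      have "cmod (?R \<zeta>) \<le> (\<Sum>\<^sub>\<infinity>n\<in>S. cmod (of_real (w n) / ((z n - \<mu>)\<^sup>2 * (z n - \<zeta>))))"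
        by (rule norm_infsum_bound[OF sR])
      also have "\<dots> \<le> C"
        unfolding C_def
      proof (rule infsum_mono[OF sR])
        show "(\<lambda>n. w n * (2 / d ^ 3)) summable_on S"
          by (intro summable_on_cmult_left w)
        fix n assume n: "n \<in> S"
        have "0 < d ^ 3 / 2"
          using d(1) by simp
        then have "w n / cmod ((z n - \<mu>)\<^sup>2 * (z n - \<zeta>)) \<le> w n / (d ^ 3 / 2)"
          using far3[OF n] w(2)[OF n] by (intro divide_left_mono mult_pos_pos) linarith+
        then show "cmod (of_real (w n) / ((z n - \<mu>)\<^sup>2 * (z n - \<zeta>))) \<le> w n * (2 / d ^ 3)"
          using w(2)[OF n] by (simp add: norm_divide)
      qed
      finally show ?thesis .
    qed
    ultimately show ?thesis
      unfolding h_def[symmetric] by (simp add: norm_mult mult_left_mono)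
  qed
  have "((\<lambda>\<zeta>. (?g \<zeta> - ?g \<mu>) / (\<zeta> - \<mu>) - ?D) \<longlongrightarrow> 0) (at \<mu>)"
  proof (rule Lim_null_comparison)
    show "\<forall>\<^sub>F \<zeta> in at \<mu>. cmod ((?g \<zeta> - ?g \<mu>) / (\<zeta> - \<mu>) - ?D) \<le> cmod (\<zeta> - \<mu>) * C"
      unfolding eventually_at using d(1) bound by (intro exI[of _ "d / 2"]) auto
    have "((\<lambda>\<zeta>. cmod (\<zeta> - \<mu>) * C) \<longlongrightarrow> cmod (\<mu> - \<mu>) * C) (at \<mu>)"
      by (intro tendsto_intros)
    then show "((\<lambda>\<zeta>. cmod (\<zeta> - \<mu>) * C) \<longlongrightarrow> 0) (at \<mu>)"
      by simp
  qed
  then show ?thesis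
    unfolding has_field_derivative_iff by (simp add: LIM_zero_iff)
qed

subsection \<open>Eigenfunctions\<close>

lemma Gfun_eq: "Gfun v z = (\<Sum>\<^sub>\<infinity>n\<in>{n. vcoeff v n \<noteq> 0}. of_real ((cmod (vcoeff v n))\<^sup>2) / (zev n - z))"
  by (simp add: Gfun_def zev_in_sigma1_iff)

lemma Im_divide_of_real: "Im (of_real w / a) = - (w / (cmod a)\<^sup>2 * Im a)"
  by (simp add: Im_divide cmod_power2)

text \<open>A zero of \<open>Qfun\<close> is real, because \<open>Im (Gfun v \<mu>)\<close> is \<open>Im \<mu>\<close> times a positive series; at a
  real point \<open>deriv (Gfun v)\<close> is that very series.\<close>

lemma deriv_Gfun_nonzero:
  assumes v: "v \<in> L2" and \<mu>: "\<mu> \<in> sigma2 \<alpha> v"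
  shows "deriv (Gfun v) \<mu> \<noteq> 0"
proof -
  define S where "S = {n. vcoeff v n \<noteq> 0}"
  define w where "w n = (cmod (vcoeff v n))\<^sup>2" for n
  define t where "t n = w n / (cmod (zev n - \<mu>))\<^sup>2" for n
  have notin: "\<mu> \<notin> zev ` S" and Q: "1 + of_real \<alpha> * Gfun v \<mu> = 0"
    using \<mu> by (auto simp: sigma2_def Qfun_def S_def zev_in_sigma1_iff)
  have G: "Gfun v \<zeta> = (\<Sum>\<^sub>\<infinity>n\<in>S. of_real (w n) / (zev n - \<zeta>))" for \<zeta>
    by (simp add: Gfun_eq S_def w_def)
  obtain d where d: "d > 0" "\<And>n. n \<in> S \<Longrightarrow> d * (1 + \<bar>real_of_int n\<bar>) ^ 3 \<le> cmod (zev n - \<mu>)"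
    using zev_cubic_separation[OF notin] by blast
  have far: "d \<le> cmod (zev n - \<mu>)" if "n \<in> S" for n
  proof -
    have "d * 1 \<le> d * (1 + \<bar>real_of_int n\<bar>) ^ 3"
      using d(1) by (intro mult_left_mono one_le_power) auto
    then show ?thesis
      using d(2)[OF that] by linarith
  qed
  have w: "w summable_on S" "\<And>n. w n \<ge> 0"
    using vcoeff_square_summable[OF v] by (auto simp: w_def[abs_def])
  have D: "deriv (Gfun v) \<mu> = (\<Sum>\<^sub>\<infinity>n\<in>S. of_real (w n) / (zev n - \<mu>)\<^sup>2)"
    unfolding G[abs_def] by (intro DERIV_imp_deriv has_field_derivative_Cauchy_transform[OF w d(1) far])
  have t_summable: "t summable_on S"
  proof (rule summable_on_comparison_test)
    show "(\<lambda>n. w n * (1 / d\<^sup>2)) summable_on S"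
      by (intro summable_on_cmult_left w)
    fix n assume "n \<in> S"
    then have "d\<^sup>2 \<le> (cmod (zev n - \<mu>))\<^sup>2"
      using far d(1) by (auto intro!: power_mono)
    moreover have "0 < d\<^sup>2"
      using d(1) by simp
    ultimately have "w n / (cmod (zev n - \<mu>))\<^sup>2 \<le> w n / d\<^sup>2"
      by (meson divide_left_mono mult_pos_pos order.strict_trans2 w(2))
    then show "t n \<le> w n * (1 / d\<^sup>2)"
      by (simp add: t_def)
  qed (simp add: t_def w)
  \<comment> \<open>A zero of \<open>Qfun\<close> excludes an empty \<open>S\<close>, so the series
    \<open>t\<close> has a strictly positive term.\<close>
  have "Gfun v \<mu> \<noteq> 0"
    using Q by auto
  then obtain m where m: "m \<in> S"
    by (cases "S = {}") (auto simp: G)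
  have "cmod (zev m - \<mu>) > 0"
    using far[OF m] d(1) by linarith
  then have "t m > 0"
    using m by (simp add: t_def w_def S_def)
  also have "t m = (\<Sum>n\<in>{m}. t n)"
    by simp
  also have "\<dots> \<le> infsum t S"
    using m by (intro finite_sum_le_infsum t_summable) (auto simp: t_def w)
  finally have pos: "infsum t S > 0" .
  \<comment> \<open>Each \<open>zev n\<close> is real, so \<open>zev n - \<mu>\<close> has imaginary
    part \<open>- Im \<mu>\<close>.\<close>
  have im: "Im (of_real (w n) / (zev n - \<mu>)) = t n * Im \<mu>" for n
    unfolding Im_divide_of_real t_def by (simp add: zev_def)
  have "(\<lambda>n. of_real (w n) / (zev n - \<mu>)) summable_on S"
  proof (rule abs_summable_summable, rule Infinite_Sum.abs_summable_on_comparison_test')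
    show "(\<lambda>n. w n * (1 / d)) summable_on S"
      by (intro summable_on_cmult_left w)
    fix n assume "n \<in> S"
    then have "w n / cmod (zev n - \<mu>) \<le> w n / d"
      using far[of n] d(1) w(2)[of n] by (intro divide_left_mono mult_pos_pos) linarith+
    then show "cmod (of_real (w n) / (zev n - \<mu>)) \<le> w n * (1 / d)"
      using w(2)[of n] by (simp add: norm_divide)
  qed
  then have "Im (Gfun v \<mu>) = (\<Sum>\<^sub>\<infinity>n\<in>S. t n * Im \<mu>)"
    unfolding G by (simp only: infsum_Im[symmetric] im)
  then have "Im (Gfun v \<mu>) = infsum t S * Im \<mu>"
    by (simp add: infsum_cmult_left')
  moreover have "Im (Gfun v \<mu>) = 0"
  proof -
    have "\<alpha> \<noteq> 0"
      using Q by auto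
    moreover have "\<alpha> * Im (Gfun v \<mu>) = 0"
      using arg_cong[OF Q, of Im] by simp
    ultimately show ?thesis by simp
  qed
  ultimately have "Im \<mu> = 0"
    using pos by simp
  \<comment> \<open>For real \<open>\<mu>\<close> the squares in the derivative are squares of reals
    and so coincide with the squared moduli in \<open>t\<close>.\<close>
  then have "zev n - \<mu> = of_real (Re (zev n - \<mu>))" for n
    by (simp add: complex_eq_iff zev_def)
  then have "of_real (w n) / (zev n - \<mu>)\<^sup>2 = of_real (t n)" for n
    unfolding t_def
    by (metis (no_types) norm_of_real of_real_divide of_real_power power2_abs)
  then have "deriv (Gfun v) \<mu> = of_real (infsum t S)"
    unfolding D by (simp only: infsumI[OF has_sum_of_real[OF has_sum_infsum[OF t_summable]]])
  then show ?thesis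
    using pos by simp
qed

text \<open>The rank-one term drops out because the inner product of \<open>ufun n\<close> with
  \<open>v\<close> is the conjugate of \<open>vcoeff v n\<close>; what remains is
  \<open>\<i> * freq n ^ 3\<close>.\<close>

lemma eigenfunction_ufun:
  assumes "vcoeff v n = 0"
  shows "eigenfunction (L_op \<alpha> v) (zev n) (ufun n)"
  unfolding eigenfunction_def
proof
  have L2: "(\<lambda>x. freq n ^ k * ufun n x) \<in> L2" for k
    by (intro L2_continuous continuous_intros)
  have "ufun n \<in> sobolev2 3"
    unfolding sobolev2_def using L2[of 0] L2 weak_deriv_ufun by auto
  moreover have "\<exists>g. continuous_on {0..1} g \<and> weak_deriv k (ufun n) g \<and> g 1 = g 0" for k
    by (intro exI[of _ "\<lambda>x. freq n ^ k * ufun n x"] conjI weak_deriv_ufun continuous_intros) simp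
  ultimately have "ufun n \<in> dom_L"
    by (simp add: dom_L_def)
  moreover have "ip (ufun n) v = cnj (vcoeff v n)"
    by (simp add: vcoeff_def ip_def mult.commute flip: Bochner_Integration.integral_cnj)
  then have "zev n * ufun n x = \<i> * (freq n ^ 3 * ufun n x) + of_real \<alpha> * ip (ufun n) v * v x" for x
    using assms by (simp add: freq_cube mult.assoc)
  ultimately show "(ufun n, \<lambda>x. zev n * ufun n x) \<in> L_op \<alpha> v"
    unfolding L_op_def using L2[of 3] weak_deriv_ufun[of 3 n] by auto
  show "\<not> (AE x in unit_int. ufun n x = 0)"
  proof
    assume "AE x in unit_int. ufun n x = 0"
    then have "AE x in unit_int. (1::complex) = 0"
      by simp
    then have "(LINT x|unit_int. (1::complex)) = (LINT x|unit_int. 0)"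
      by (intro integral_cong_AE) auto
    then show False
      using integral_ufun[of 0] by simp
  qed
qed

lemma eigenfunction_utilde:
  assumes v: "v \<in> L2" and \<mu>: "\<mu> \<in> sigma2 \<alpha> v"
  shows "eigenfunction (L_op \<alpha> v) \<mu> (utilde v \<mu>)"
proof -
  define S where "S = {n. vcoeff v n \<noteq> 0}"
  define K where "K = 1 / csqrt (deriv (Gfun v) \<mu>)"
  define a where "a n = K * (vcoeff v n / (zev n - \<mu>))" for n
  let ?y = "\<lambda>x. \<Sum>\<^sub>\<infinity>n\<in>S. a n * ufun n x"
  let ?d = "\<lambda>k x. \<Sum>\<^sub>\<infinity>n\<in>S. (freq n ^ k * a n) * ufun n x"
  have K: "K \<noteq> 0"
    using deriv_Gfun_nonzero[OF assms] by (simp add: K_def)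
  have notin: "\<mu> \<notin> zev ` S" and Q: "1 + of_real \<alpha> * Gfun v \<mu> = 0"
    using \<mu> by (auto simp: sigma2_def Qfun_def S_def zev_in_sigma1_iff)
  have y_eq: "utilde v \<mu> = ?y"
  proof
    fix x
    have "utilde v \<mu> x = K * (\<Sum>\<^sub>\<infinity>n\<in>S. vcoeff v n / (zev n - \<mu>) * ufun n x)"
      by (simp add: utilde_def K_def S_def zev_in_sigma1_iff)
    also have "\<dots> = ?y x"
      unfolding a_def mult.assoc by (rule infsum_cmult_right'[symmetric])
    finally show "utilde v \<mu> x = ?y x" .
  qed
  have summable: "(\<lambda>n. cmod (freq n ^ k * a n)) summable_on S" if "k \<le> 2" for k
    using summable_on_cmult_right[OF resolvent_coefficients_summable[OF v notin that], of "cmod K"]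
    by (simp add: a_def norm_mult norm_power norm_divide mult_ac)
  have a: "(\<lambda>n. cmod (a n)) summable_on S"
    using summable[of 0] by simp
  have cont: "continuous_on T (?d k)" if "k \<le> 2" for k T
    by (rule continuous_on_ufun_series[OF summable[OF that]])
  have cont_y: "continuous_on T ?y" for T
    by (rule continuous_on_ufun_series[OF a])
  have wd: "weak_deriv k ?y (?d k)" if "k \<le> 2" for k
    by (rule weak_deriv_ufun_series[OF a summable[OF that]])
  \<comment> \<open>Obtained by solving the eigenvalue equation for the third derivative, with
    \<open>- K\<close> in place of \<open>of_real \<alpha> * ip ?y v\<close>.\<close>
  define y3 where "y3 x = - \<i> * (K * v x + \<mu> * ?y x)" for x
  have y_L2: "?y \<in> L2"
    by (rule L2_continuous[OF cont_y])
  have y3_L2: "y3 \<in> L2"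
    unfolding y3_def[abs_def] by (intro L2_cmult L2_add v y_L2)
  have wd3: "weak_deriv 3 ?y y3"
    unfolding weak_deriv_def
  proof (intro allI impI)
    fix \<phi> assume \<phi>: "test_function \<phi>"
    let ?P = "\<lambda>n. LINT x|unit_int. ufun n x * of_real (\<phi> x)"
    let ?I = "\<lambda>f. LINT x|unit_int. f x * of_real (\<phi> x)"
    have int: "integrable unit_int (\<lambda>x. of_real ((deriv ^^ k) \<phi> x) :: complex)" for k
      by (intro integrable_unit_int_continuous continuous_intros continuous_on_test_function_derivs \<phi>)
    have lhs: "((\<lambda>n. a n * ((- freq n) ^ 3 * ?P n)) has_sum
        (LINT x|unit_int. ?y x * of_real ((deriv ^^ 3) \<phi> x))) S"
      using ufun_series_integral[OF a int[of 3]]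
      by (simp only: integral_ufun_test_function_derivs[OF \<phi>])
    \<comment> \<open>Outside \<open>S\<close> the coefficients of \<open>v\<close> vanish, so the
      sum over all integers restricts to \<open>S\<close>.\<close>
    have "((\<lambda>n. vcoeff v n * ?P n) has_sum ?I v) S"
      using Parseval_test_function[OF v \<phi>]
      by (subst has_sum_cong_neutral[where T = UNIV]) (auto simp: S_def)
    moreover have "((\<lambda>n. a n * ?P n) has_sum ?I ?y) S"
      using ufun_series_integral[OF a int[of 0]] by simp
    ultimately have "((\<lambda>n. \<i> * (K * (vcoeff v n * ?P n) + \<mu> * (a n * ?P n))) has_sum
        (\<i> * (K * ?I v + \<mu> * ?I ?y))) S"
      by (intro has_sum_cmult_right has_sum_add)
    also have "?this \<longleftrightarrow> ((\<lambda>n. a n * ((- freq n) ^ 3 * ?P n)) has_sum (\<i> * (K * ?I v + \<mu> * ?I ?y))) S"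
    proof (rule has_sum_cong)
      fix n assume "n \<in> S"
      then have "zev n - \<mu> \<noteq> 0"
        using notin by auto
      \<comment> \<open>This is \<open>zev n * a n = K * vcoeff v n + \<mu> * a n\<close>: the cubic
        factor turns the series of \<open>?y\<close> into those of \<open>v\<close> and
        \<open>?y\<close>.\<close>
      then have Kv: "K * vcoeff v n = a n * (zev n - \<mu>)"
        by (simp add: a_def)
      have "(- freq n) ^ 3 = \<i> * zev n"
        using freq_cube[of n] by (simp add: power3_eq_cube)
      then have "a n * ((- freq n) ^ 3 * ?P n) = \<i> * (a n * (zev n - \<mu>) + \<mu> * a n) * ?P n"
        by (simp add: algebra_simps)
      then show "\<i> * (K * (vcoeff v n * ?P n) + \<mu> * (a n * ?P n)) = a n * ((- freq n) ^ 3 * ?P n)"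
        unfolding Kv[symmetric] by (simp add: algebra_simps)
    qed
    finally have "(LINT x|unit_int. ?y x * of_real ((deriv ^^ 3) \<phi> x)) = \<i> * (K * ?I v + \<mu> * ?I ?y)"
      by (rule has_sum_unique[OF lhs])
    also have "K * ?I v + \<mu> * ?I ?y = (LINT x|unit_int. K * (v x * of_real (\<phi> x)) + \<mu> * (?y x * of_real (\<phi> x)))"
    proof -
      have "integrable unit_int (\<lambda>x. of_real (\<phi> x) * f x)" if "f \<in> L2" for f
        by (intro integrable_unit_int_mult_continuous L2_integrable that continuous_intros
            continuous_on_test_function_derivs[OF \<phi>, of _ 0, simplified])
      from this[OF v] this[OF y_L2] show ?thesis
        by (simp add: mult.commute[of "of_real _"])
    qed
    also have "\<i> * \<dots> = (LINT x|unit_int. (-1) * (y3 x * of_real (\<phi> x)))"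
      unfolding integral_mult_right_zero[symmetric]
      by (intro Bochner_Integration.integral_cong refl) (simp add: y3_def algebra_simps)
    also have "\<dots> = (-1) ^ 3 * ?I y3"
      by simp
    finally show "(LINT x|unit_int. ?y x * of_real ((deriv ^^ 3) \<phi> x)) = (-1) ^ 3 * ?I y3" .
  qed
  have "\<exists>g\<in>L2. weak_deriv k ?y g" if "k \<le> 3" for k
  proof (cases "k = 3")
    case True
    then show ?thesis using wd3 y3_L2 by blast
  next
    case False
    then have "k \<le> 2" using that by simp
    then show ?thesis using wd L2_continuous[OF cont] by blast
  qed
  then have "?y \<in> sobolev2 3"
    unfolding sobolev2_def using y_L2 by blast
  \<comment> \<open>Every exponential equals 1 at both endpoints, so the two boundary values are the
    same sum of coefficients.\<close>
  moreover have "\<exists>g. continuous_on {0..1} g \<and> weak_deriv k ?y g \<and> g 1 = g 0" if "k \<le> 2" for k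
    using wd[OF that] cont[OF that] by (intro exI[of _ "?d k"]) simp
  ultimately have y_dom: "?y \<in> dom_L"
    by (simp add: dom_L_def)
  \<comment> \<open>Each term pairs with \<open>v\<close> to \<open>a n * cnj (vcoeff v n)\<close>,
    which is \<open>K\<close> times a term of the series \<open>Gfun v \<mu>\<close>.\<close>
  have ip: "ip ?y v = K * Gfun v \<mu>"
  proof -
    have "((\<lambda>n. a n * (LINT x|unit_int. ufun n x * cnj (v x))) has_sum ip ?y v) S"
      unfolding ip_def by (intro ufun_series_integral a integrable_cnj L2_integrable v)
    moreover have "(LINT x|unit_int. ufun n x * cnj (v x)) = cnj (vcoeff v n)" for n
      by (simp add: vcoeff_def ip_def mult.commute flip: Bochner_Integration.integral_cnj)
    ultimately have "ip ?y v = (\<Sum>\<^sub>\<infinity>n\<in>S. K * (of_real ((cmod (vcoeff v n))\<^sup>2) / (zev n - \<mu>)))"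
      by (subst infsumI[symmetric]) (simp_all add: a_def complex_norm_square mult_ac del: of_real_power)
    then show ?thesis
      unfolding Gfun_eq S_def infsum_cmult_right' .
  qed
  have \<alpha>_ip: "of_real \<alpha> * ip ?y v = - K"
    using Q unfolding ip by algebra
  have "\<mu> * ?y x = \<i> * y3 x + of_real \<alpha> * ip ?y v * v x" for x
    unfolding \<alpha>_ip y3_def by (simp add: algebra_simps)
  then have "(?y, \<lambda>x. \<mu> * ?y x) \<in> L_op \<alpha> v"
    unfolding L_op_def using y_dom y3_L2 wd3 by blast
  \<comment> \<open>If \<open>?y\<close> vanished almost everywhere, so would its inner product with
    \<open>v\<close>, contrary to \<open>\<alpha>_ip\<close> and
    \<open>K \<noteq> 0\<close>.\<close>
  moreover have "\<not> (AE x in unit_int. ?y x = 0)"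
  proof
    assume "AE x in unit_int. ?y x = 0"
    then have "AE x in unit_int. ?y x * cnj (v x) = 0"
      by eventually_elim simp
    then have "ip ?y v = 0"
      unfolding ip_def by (rule integral_eq_zero_AE)
    then show False
      using \<alpha>_ip K by simp
  qed
  ultimately show ?thesis
    unfolding y_eq eigenfunction_def by blast
qed

theorem proposition4p6:
  fixes \<alpha> :: real and v :: "real \<Rightarrow> complex"
  assumes "v \<in> L2"
  shows "(\<forall>n. zev n \<in> sigma0 v \<longrightarrow> eigenfunction (L_op \<alpha> v) (zev n) (ufun n)) \<and>
         (\<forall>\<mu>\<in>sigma2 \<alpha> v. eigenfunction (L_op \<alpha> v) \<mu> (utilde v \<mu>))"
  using eigenfunction_ufun eigenfunction_utilde[OF assms] zev_in_sigma0_iff by blast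

end
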